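(* Every parental universe $\mathbb U$ of combinatorial games is outcome saturated: for all $G\in\mathbb U$ and every pair $x,y\in\mathcal S$ there is an $H\in\mathbb U$ such that $o_L(G+H)\ge x$ and $o_R(G+H)\le y$.
   Context: **Game forms.** Let $\mathcal A$ be a totally ordered additive abelian group. An atom $\emptyset^a$ ($a\in\mathcal A$) is an empty set of options adorned with $a$. Let $\Omega_0=\{\{\emptyset^\ell\mid\emptyset^r\}:\ell,r\in\mathcal A\}$, and for $n>0$ let $\Omega_n$ be the set of all forms $G=\{G^{\mathcal L}\mid G^{\mathcal R}\}$ in which each of $G^{\mathcal L}$ (set of Left options) and $G^{\mathcal R}$ (set of Right options) is either an atom or a non-empty finite set of elements of $\Omega_{n-1}$. Put $\Omega=\bigcup_n\Omega_n$ (the free space $(\Omega,\mathcal A)$). **Disjunctive sum.** $G+H$ is defined recursively: if $G^{\mathcal L}=\emptyset^{\ell_1}$ and $H^{\mathcal L}=\emptyset^{\ell_2}$, then the Left side of $G+H$ is $\emptyset^{\ell_1+\ell_2}$; otherwise its Left options are all $G^L+H$ and all $G+H^L$ (with $G^L$, $H^L$ ranging over Left options). The Right side is defined analogously. **Conjugate.** The conjugate of $G$ is obtained recursively by swapping the Left and Right sides, conjugating all options, and negating adorns (an atom $\emptyset^{a}$ on one side becomes $\emptyset^{-a}$ on the other side). **Universe.** A universe is a subset $\mathbb U\subseteq\Omega$ such that $\{\emptyset^a\mid\emptyset^a\}\in\mathbb U$ for all $a\in\mathcal A$, and $\mathbb U$ is closed under taking options, disjunctive sums and conjugates. It is parental if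 $\{\mathcal G\mid\mathcal H\}\in\mathbb U$ for all finite non-empty $\mathcal G,\mathcal H\subset\mathbb U$. **Evaluation and outcomes.** There are a totally ordered set $\mathcal S$ and order preserving maps $\nu_L,\nu_R:\mathcal A\to\mathcal S$; if $|\mathcal A|>1$ (scoring-play) then $\nu_L=\nu_R$. By convention $\mathcal S=\nu_L(\mathcal A)\cup\nu_R(\mathcal A)$. Outcomes: $o_L(G)=\nu_L(\ell)$ if $G^{\mathcal L}=\emptyset^\ell$, otherwise $o_L(G)=\max_{G^L} o_R(G^L)$; $o_R(G)=\nu_R(r)$ if $G^{\mathcal R}=\emptyset^r$, otherwise $o_R(G)=\min_{G^R}o_L(G^R)$. *)

theory Defs
  imports Complex_Main "HOL-Library.FSet"
begin

(* The types also contain junk: forms with a side Options {||}. These are excluded by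
   free_space, of which every universe is a subset. *)
datatype 'a game = Game (left: "'a side") (right: "'a side")
  and 'a side = Atom 'a | Options "'a game fset"

fun opts :: "'a side \<Rightarrow> 'a game fset" where
  "opts (Atom a) = {||}"
| "opts (Options F) = F"

fun side_over :: "'a game set \<Rightarrow> 'a side \<Rightarrow> bool" where
  "side_over X (Atom a) \<longleftrightarrow> True"
| "side_over X (Options F) \<longleftrightarrow> F \<noteq> {||} \<and> fset F \<subseteq> X"

fun Omega :: "nat \<Rightarrow> 'a game set" where
  "Omega 0 = {Game (Atom l) (Atom r) | l r. True}"
| "Omega (Suc n) = {Game L R | L R. side_over (Omega n) L \<and> side_over (Omega n) R}"

definition free_space :: "'a game set" where
  "free_space = (\<Union>n. Omega n)"

lemma size_opts_less:
  assumes "G |\<in>| opts X"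
  shows "size G < size X"
proof (cases X)
  case (Atom a)
  then show ?thesis using assms by simp
next
  case (Options F)
  then have "G \<in> fset F" using assms by simp
  then have "Suc (size G) \<le> (\<Sum>x\<in>fset F. Suc (size x))"
    by (intro member_le_sum) auto
  then show ?thesis using Options by simp
qed

lemma size_left_option [termination_simp]: "G' |\<in>| opts (left G) \<Longrightarrow> size G' < size G"
  and size_right_option [termination_simp]: "G' |\<in>| opts (right G) \<Longrightarrow> size G' < size G"
  by (cases G; force dest: size_opts_less)+

fun side_sum :: "'a::plus side \<Rightarrow> 'a side \<Rightarrow> 'a game fset \<Rightarrow> 'a side" where
  "side_sum (Atom a) (Atom b) F = Atom (a + b)"
| "side_sum X Y F = Options F"

context
  notes fimage_cong [fundef_cong]
begin

function game_sum :: "'a::plus game \<Rightarrow> 'a game \<Rightarrow> 'a game" (infixl "\<oplus>" 65) where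
  "G \<oplus> H = Game
     (side_sum (left G) (left H)
        ((\<lambda>G'. G' \<oplus> H) |`| opts (left G) |\<union>| (\<lambda>H'. G \<oplus> H') |`| opts (left H)))
     (side_sum (right G) (right H)
        ((\<lambda>G'. G' \<oplus> H) |`| opts (right G) |\<union>| (\<lambda>H'. G \<oplus> H') |`| opts (right H)))"
  by pat_completeness auto
termination
  by (relation "measure (\<lambda>(G, H). size G + size H)")
    (auto dest: size_left_option size_right_option)

end

declare game_sum.simps [simp del]

primrec conjugate :: "'a::uminus game \<Rightarrow> 'a game"
  and conjugate_side :: "'a::uminus side \<Rightarrow> 'a side" where
  "conjugate (Game L R) = Game (conjugate_side R) (conjugate_side L)"
| "conjugate_side (Atom a) = Atom (- a)"
| "conjugate_side (Options F) = Options (conjugate |`| F)"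

definition universe :: "'a::linordered_ab_group_add game set \<Rightarrow> bool" where
  "universe U \<longleftrightarrow>
     U \<subseteq> free_space \<and>
     (\<forall>a. Game (Atom a) (Atom a) \<in> U) \<and>
     (\<forall>G\<in>U. fset (opts (left G)) \<subseteq> U \<and> fset (opts (right G)) \<subseteq> U) \<and>
     (\<forall>G\<in>U. \<forall>H\<in>U. G \<oplus> H \<in> U) \<and>
     (\<forall>G\<in>U. conjugate G \<in> U)"

definition parental :: "'a game set \<Rightarrow> bool" where
  "parental U \<longleftrightarrow>
     (\<forall>F F'. F \<noteq> {||} \<and> F' \<noteq> {||} \<and> fset F \<subseteq> U \<and> fset F' \<subseteq> U
        \<longrightarrow> Game (Options F) (Options F') \<in> U)"

definition evaluation ::
  "'s::linorder set \<Rightarrow> ('a::linordered_ab_group_add \<Rightarrow> 's) \<Rightarrow> ('a \<Rightarrow> 's) \<Rightarrow> bool" where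
  "evaluation S \<nu>L \<nu>R \<longleftrightarrow>
     S = range \<nu>L \<union> range \<nu>R \<and> mono \<nu>L \<and> mono \<nu>R \<and>
     ((\<exists>a b :: 'a. a \<noteq> b) \<longrightarrow> \<nu>L = \<nu>R)"

context
  fixes \<nu>L \<nu>R :: "'a \<Rightarrow> 's::linorder"
  notes fimage_cong [fundef_cong]
begin

function oL :: "'a game \<Rightarrow> 's" and oR :: "'a game \<Rightarrow> 's" where
  "oL (Game (Atom l) R) = \<nu>L l"
| "oL (Game (Options F) R) = fMax (oR |`| F)"
| "oR (Game L (Atom r)) = \<nu>R r"
| "oR (Game L (Options F)) = fMin (oL |`| F)"
  by pat_completeness auto
termination
proof (relation "measure (case_sum size size)")
  show "(Inr G, Inl (Game (Options F) R)) \<in> measure (case_sum size size)"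
    if "G |\<in>| F" for G :: "'a game" and F R
    using size_left_option[of G "Game (Options F) R"] that by simp
  show "(Inl G, Inr (Game L (Options F))) \<in> measure (case_sum size size)"
    if "G |\<in>| F" for G :: "'a game" and F L
    using size_right_option[of G "Game L (Options F)"] that by simp
qed simp

end

definition outcome_saturated ::
  "'s::linorder set \<Rightarrow> ('a::linordered_ab_group_add \<Rightarrow> 's) \<Rightarrow> ('a \<Rightarrow> 's) \<Rightarrow> 'a game set \<Rightarrow> bool"
  where
  "outcome_saturated S \<nu>L \<nu>R U \<longleftrightarrow>
     (\<forall>G\<in>U. \<forall>x\<in>S. \<forall>y\<in>S. \<exists>H\<in>U. oL \<nu>L \<nu>R (G \<oplus> H) \<ge> x \<and> oR \<nu>L \<nu>R (G \<oplus> H) \<le> y)"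

end

theory Submission
  imports Defs
begin

text \<open>
  It suffices to find \<open>H\<^sub>1, H\<^sub>2 \<in> U\<close> with \<open>oR (G \<oplus> H\<^sub>1) \<ge> x\<close> and \<open>oL (G \<oplus> H\<^sub>2) \<le> y\<close>, since
  then \<open>H = {H\<^sub>1 | H\<^sub>2}\<close> lies in \<open>U\<close> by parentality and both players may open by moving in \<open>H\<close>.
  If \<open>\<nu>L = \<nu>R\<close>, take numbers \<open>{\<emptyset>\<^sup>a | \<emptyset>\<^sup>a}\<close> with \<open>a\<close> sufficiently large or small. Otherwise the
  group is trivial and \<open>S\<close> has at most two elements, and one \<open>H\<^sub>1 = H\<^sub>2\<close> is wanted for which
  the second player wins \<open>G \<oplus> H\<^sub>1\<close>. If \<open>\<nu>L 0 \<le> \<nu>R 0\<close> (normal play) it is the conjugate of \<open>G\<close>.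
  If \<open>\<nu>R 0 \<le> \<nu>L 0\<close> (misere play) it is the adjoint of \<open>G\<close>: the conjugate with every empty
  side replaced by the single option \<open>0\<close>, so that a player moving to that \<open>0\<close> leaves
  the opponent without a move, which wins for the opponent.
\<close>

section \<open>Moves and outcomes in disjunctive sums\<close>

lemma left_game_sum:
  "left (G \<oplus> H) = side_sum (left G) (left H)
     ((\<lambda>G'. G' \<oplus> H) |`| opts (left G) |\<union>| (\<lambda>H'. G \<oplus> H') |`| opts (left H))"
  by (subst game_sum.simps) simp

lemma right_game_sum:
  "right (G \<oplus> H) = side_sum (right G) (right H)
     ((\<lambda>G'. G' \<oplus> H) |`| opts (right G) |\<union>| (\<lambda>H'. G \<oplus> H') |`| opts (right H))"
  by (subst game_sum.simps) simp

lemma side_sum_eq_Options: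
  "opts X \<noteq> {||} \<or> opts Y \<noteq> {||} \<Longrightarrow> side_sum X Y F = Options F"
  by (cases X; cases Y) auto

lemma oL_Options: "left G = Options F \<Longrightarrow> oL \<nu>L \<nu>R G = fMax (oR \<nu>L \<nu>R |`| F)"
  by (cases G) simp

lemma oR_Options: "right G = Options F \<Longrightarrow> oR \<nu>L \<nu>R G = fMin (oL \<nu>L \<nu>R |`| F)"
  by (cases G) simp

lemma oL_Atom: "left G = Atom l \<Longrightarrow> oL \<nu>L \<nu>R G = \<nu>L l"
  by (cases G) simp

lemma oR_Atom: "right G = Atom r \<Longrightarrow> oR \<nu>L \<nu>R G = \<nu>R r"
  by (cases G) simp

lemma oR_option_le_oL: "G' |\<in>| opts (left G) \<Longrightarrow> oR \<nu>L \<nu>R G' \<le> oL \<nu>L \<nu>R G"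
  by (cases "left G") (auto simp: oL_Options)

lemma oR_le_oL_option: "G' |\<in>| opts (right G) \<Longrightarrow> oR \<nu>L \<nu>R G \<le> oL \<nu>L \<nu>R G'"
  by (cases "right G") (auto simp: oR_Options)

lemma left_option_sum:
  "G' |\<in>| opts (left G) \<Longrightarrow> G' \<oplus> H |\<in>| opts (left (G \<oplus> H))"
  "H' |\<in>| opts (left H) \<Longrightarrow> G \<oplus> H' |\<in>| opts (left (G \<oplus> H))"
  by (subst left_game_sum, subst side_sum_eq_Options, force, force)+

lemma right_option_sum:
  "G' |\<in>| opts (right G) \<Longrightarrow> G' \<oplus> H |\<in>| opts (right (G \<oplus> H))"
  "H' |\<in>| opts (right H) \<Longrightarrow> G \<oplus> H' |\<in>| opts (right (G \<oplus> H))"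
  by (subst right_game_sum, subst side_sum_eq_Options, force, force)+

text \<open>A single good move already bounds the outcome in the mover's favour. Fact
  \<open>(1)\<close> moves in the first summand, fact \<open>(2)\<close> in the second.\<close>

lemmas oL_sum_ge = left_option_sum[THEN oR_option_le_oL]
lemmas oR_sum_le = right_option_sum[THEN oR_le_oL_option]

text \<open>Excludes the junk side \<open>Options {||}\<close>, at which outcomes are unspecified.\<close>

definition proper :: "'a game \<Rightarrow> bool" where
  "proper G \<longleftrightarrow> left G \<noteq> Options {||} \<and> right G \<noteq> Options {||}"

text \<open>Opposite direction to \<open>oL_sum_ge\<close>: every Left move in either summand has to
  be checked, as well as the final score if there is none. Properness turns a side without options
  into an atom.\<close>

lemma oL_sum_leI:
  assumes "proper G" "proper H"
    and "\<And>G'. G' |\<in>| opts (left G) \<Longrightarrow> oR \<nu>L \<nu>R (G' \<oplus> H) \<le> y"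
    and "\<And>H'. H' |\<in>| opts (left H) \<Longrightarrow> oR \<nu>L \<nu>R (G \<oplus> H') \<le> y"
    and "\<And>a b. left G = Atom a \<Longrightarrow> left H = Atom b \<Longrightarrow> \<nu>L (a + b) \<le> y"
  shows "oL \<nu>L \<nu>R (G \<oplus> H) \<le> y"
proof (cases "opts (left G) = {||} \<and> opts (left H) = {||}")
  case True
  then obtain a b where ab: "left G = Atom a" "left H = Atom b"
    using assms(1,2) by (cases "left G"; cases "left H") (auto simp: proper_def)
  then show ?thesis
    using assms(5)[OF ab] by (simp add: oL_Atom left_game_sum)
next
  case False
  let ?F = "(\<lambda>G'. G' \<oplus> H) |`| opts (left G) |\<union>| (\<lambda>H'. G \<oplus> H') |`| opts (left H)"
  have "left (G \<oplus> H) = Options ?F"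
    using False by (subst left_game_sum, intro side_sum_eq_Options) auto
  moreover have "?F \<noteq> {||}"
    using False by auto
  ultimately show ?thesis
    using assms(3,4) fMax_in[of "oR \<nu>L \<nu>R |`| ?F"] by (auto simp: oL_Options)
qed

lemma oR_sum_geI:
  assumes "proper G" "proper H"
    and "\<And>G'. G' |\<in>| opts (right G) \<Longrightarrow> x \<le> oL \<nu>L \<nu>R (G' \<oplus> H)"
    and "\<And>H'. H' |\<in>| opts (right H) \<Longrightarrow> x \<le> oL \<nu>L \<nu>R (G \<oplus> H')"
    and "\<And>a b. right G = Atom a \<Longrightarrow> right H = Atom b \<Longrightarrow> x \<le> \<nu>R (a + b)"
  shows "x \<le> oR \<nu>L \<nu>R (G \<oplus> H)"
proof (cases "opts (right G) = {||} \<and> opts (right H) = {||}")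
  case True
  then obtain a b where ab: "right G = Atom a" "right H = Atom b"
    using assms(1,2) by (cases "right G"; cases "right H") (auto simp: proper_def)
  then show ?thesis
    using assms(5)[OF ab] by (simp add: oR_Atom right_game_sum)
next
  case False
  let ?F = "(\<lambda>G'. G' \<oplus> H) |`| opts (right G) |\<union>| (\<lambda>H'. G \<oplus> H') |`| opts (right H)"
  have "right (G \<oplus> H) = Options ?F"
    using False by (subst right_game_sum, intro side_sum_eq_Options) auto
  moreover have "?F \<noteq> {||}"
    using False by auto
  ultimately show ?thesis
    using assms(3,4) fMin_in[of "oL \<nu>L \<nu>R |`| ?F"] by (auto simp: oR_Options)
qed

section \<open>Universes and induction over their members\<close>

lemma proper_free_space:
  assumes "G \<in> free_space"
  shows "proper G"
proof -
  obtain n where "G \<in> Omega n"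
    using assms by (auto simp: free_space_def)
  then show ?thesis
    by (cases n) (auto simp: proper_def)
qed

lemma universe_proper: "universe U \<Longrightarrow> G \<in> U \<Longrightarrow> proper G"
  by (auto simp: universe_def intro: proper_free_space)

lemma universe_number: "universe U \<Longrightarrow> Game (Atom a) (Atom a) \<in> U"
  by (simp add: universe_def)

lemma universe_conjugate: "universe U \<Longrightarrow> G \<in> U \<Longrightarrow> conjugate G \<in> U"
  by (simp add: universe_def)

lemma universe_option:
  assumes "universe U" "G \<in> U"
  shows "G' |\<in>| opts (left G) \<Longrightarrow> G' \<in> U" "G' |\<in>| opts (right G) \<Longrightarrow> G' \<in> U"
  using assms unfolding universe_def by auto

lemma universe_induct [consumes 2, case_names step]:
  assumes "universe U" "G \<in> U"
    and step: "\<And>G. G \<in> U \<Longrightarrow> (\<And>G'. G' |\<in>| opts (left G) \<Longrightarrow> P G') \<Longrightarrow>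
                 (\<And>G'. G' |\<in>| opts (right G) \<Longrightarrow> P G') \<Longrightarrow> P G"
  shows "P G"
  using assms(2)
proof (induction "size G" arbitrary: G rule: less_induct)
  case less
  then show ?case
    using universe_option[OF assms(1) less.prems] size_left_option size_right_option
    by (metis step)
qed

lemma opts_conjugate:
  "opts (left (conjugate G)) = conjugate |`| opts (right G)"
  "opts (right (conjugate G)) = conjugate |`| opts (left G)"
proof -
  have "opts (conjugate_side X) = conjugate |`| opts X" for X :: "'a side"
    by (cases X) auto
  then show "opts (left (conjugate G)) = conjugate |`| opts (right G)"
    and "opts (right (conjugate G)) = conjugate |`| opts (left G)"
    by (cases G, simp)+
qed

section \<open>Equal evaluation maps: adding a large or small number\<close>

text \<open>Play alternates, so the bounds on \<open>oL\<close> and \<open>oR\<close> need each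
  other in the induction. Saying "eventually in \<open>a\<close>" merges the thresholds of finitely
  many options without computing them.\<close>

lemma eventually_outcome_ge:
  fixes \<nu> :: "'a::linordered_ab_group_add \<Rightarrow> 's::linorder"
  assumes "mono \<nu>" "universe U" "G \<in> U"
  shows "\<forall>\<^sub>F a in at_top. \<nu> c \<le> oL \<nu> \<nu> (G \<oplus> Game (Atom a) (Atom a)) \<and>
           \<nu> c \<le> oR \<nu> \<nu> (G \<oplus> Game (Atom a) (Atom a))"
  using assms(2,3)
proof (induction rule: universe_induct)
  case (step G)
  let ?N = "\<lambda>a. Game (Atom a) (Atom a)"
  have atom: "\<forall>\<^sub>F a in at_top. \<nu> c \<le> \<nu> (l + a)" for l
    using eventually_ge_at_top[of "c - l"]
    by eventually_elim (auto intro!: monoD[OF assms(1)] simp: algebra_simps)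
  \<comment> \<open>Left to move needs just one option; for Right to move, all Right options must be
    covered.\<close>
  have "\<forall>\<^sub>F a in at_top. \<nu> c \<le> oL \<nu> \<nu> (G \<oplus> ?N a)"
  proof (cases "left G")
    case (Atom l)
    then show ?thesis
      using atom by (simp add: oL_Atom left_game_sum)
  next
    case (Options F)
    then obtain G' where G': "G' |\<in>| opts (left G)"
      using universe_proper[OF assms(2) step.hyps] by (auto simp: proper_def)
    from step.IH(1)[OF G'] show ?thesis
      by eventually_elim (use oL_sum_ge(1)[OF G'] order_trans in blast)
  qed
  moreover have "\<forall>\<^sub>F a in at_top. \<forall>G'\<in>fset (opts (right G)). \<nu> c \<le> oL \<nu> \<nu> (G' \<oplus> ?N a)"
    using step.IH(2) by (intro eventually_ball_finite) (auto simp: eventually_conj_iff)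
  \<comment> \<open>Vacuous unless the Right side is an atom; in this form it serves
    \<open>oR_sum_geI\<close> without a case split.\<close>
  moreover have "\<forall>\<^sub>F a in at_top. \<forall>r. right G = Atom r \<longrightarrow> \<nu> c \<le> \<nu> (r + a)"
    using atom by (cases "right G") auto
  ultimately show ?case
  proof eventually_elim
    case (elim a)
    moreover have "\<nu> c \<le> oR \<nu> \<nu> (G \<oplus> ?N a)"
      using elim universe_proper[OF assms(2) step.hyps]
        universe_proper[OF assms(2) universe_number[OF assms(2)]]
      by (intro oR_sum_geI) auto
    ultimately show ?case by simp
  qed
qed

text \<open>Mirror image of \<open>eventually_outcome_ge\<close>, with the players exchanged and
  \<open>a\<close> tending downwards.\<close>

lemma eventually_outcome_le:
  fixes \<nu> :: "'a::linordered_ab_group_add \<Rightarrow> 's::linorder"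
  assumes "mono \<nu>" "universe U" "G \<in> U"
  shows "\<forall>\<^sub>F a in at_bot. oL \<nu> \<nu> (G \<oplus> Game (Atom a) (Atom a)) \<le> \<nu> c \<and>
           oR \<nu> \<nu> (G \<oplus> Game (Atom a) (Atom a)) \<le> \<nu> c"
  using assms(2,3)
proof (induction rule: universe_induct)
  case (step G)
  let ?N = "\<lambda>a. Game (Atom a) (Atom a)"
  have atom: "\<forall>\<^sub>F a in at_bot. \<nu> (l + a) \<le> \<nu> c" for l
    using eventually_le_at_bot[of "c - l"]
    by eventually_elim (auto intro!: monoD[OF assms(1)] simp: algebra_simps)
  have "\<forall>\<^sub>F a in at_bot. oR \<nu> \<nu> (G \<oplus> ?N a) \<le> \<nu> c"
  proof (cases "right G")
    case (Atom r)
    then show ?thesis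
      using atom by (simp add: oR_Atom right_game_sum)
  next
    case (Options F)
    then obtain G' where G': "G' |\<in>| opts (right G)"
      using universe_proper[OF assms(2) step.hyps] by (auto simp: proper_def)
    from step.IH(2)[OF G'] show ?thesis
      by eventually_elim (use oR_sum_le(1)[OF G'] order_trans in blast)
  qed
  moreover have "\<forall>\<^sub>F a in at_bot. \<forall>G'\<in>fset (opts (left G)). oR \<nu> \<nu> (G' \<oplus> ?N a) \<le> \<nu> c"
    using step.IH(1) by (intro eventually_ball_finite) (auto simp: eventually_conj_iff)
  moreover have "\<forall>\<^sub>F a in at_bot. \<forall>l. left G = Atom l \<longrightarrow> \<nu> (l + a) \<le> \<nu> c"
    using atom by (cases "left G") auto
  ultimately show ?case
  proof eventually_elim
    case (elim a)
    moreover have "oL \<nu> \<nu> (G \<oplus> ?N a) \<le> \<nu> c"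
      using elim universe_proper[OF assms(2) step.hyps]
        universe_proper[OF assms(2) universe_number[OF assms(2)]]
      by (intro oL_sum_leI) auto
    ultimately show ?case by simp
  qed
qed

section \<open>Second-player strategies over the trivial group\<close>

text \<open>The second player copies each move in the other component, returning to a sum of an
  option of \<open>G\<close> and its conjugate. Hence the first player is the one who runs out of
  moves.\<close>

lemma outcome_sum_conjugate:
  fixes \<nu>L \<nu>R :: "'a::linordered_ab_group_add \<Rightarrow> 's::linorder"
  assumes trivial: "\<And>a :: 'a. a = 0" and "universe U" "G \<in> U"
  shows "oL \<nu>L \<nu>R (G \<oplus> conjugate G) \<le> \<nu>L 0 \<and> \<nu>R 0 \<le> oR \<nu>L \<nu>R (G \<oplus> conjugate G)"
  using assms(2,3)
proof (induction rule: universe_induct)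
  case (step G)
  \<comment> \<open>Left has moved to \<open>G'\<close>; Right answers by moving from
    \<open>conjugate G\<close> to \<open>conjugate G'\<close>.\<close>
  have "oR \<nu>L \<nu>R (G' \<oplus> conjugate G) \<le> \<nu>L 0" if "G' |\<in>| opts (left G)" for G'
    using step.IH(1)[OF that] oR_sum_le(2)[of "conjugate G'" "conjugate G" \<nu>L \<nu>R G'] that
    by (auto simp: opts_conjugate intro: order_trans)
  moreover have "oR \<nu>L \<nu>R (G \<oplus> conjugate G') \<le> \<nu>L 0" if "G' |\<in>| opts (right G)" for G'
    using step.IH(2)[OF that] oR_sum_le(1)[OF that, of \<nu>L \<nu>R "conjugate G'"]
    by (blast intro: order_trans)
  moreover have "\<nu>R 0 \<le> oL \<nu>L \<nu>R (G' \<oplus> conjugate G)" if "G' |\<in>| opts (right G)" for G'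
    using step.IH(2)[OF that] oL_sum_ge(2)[of "conjugate G'" "conjugate G" \<nu>L \<nu>R G'] that
    by (auto simp: opts_conjugate intro: order_trans)
  moreover have "\<nu>R 0 \<le> oL \<nu>L \<nu>R (G \<oplus> conjugate G')" if "G' |\<in>| opts (left G)" for G'
    using step.IH(1)[OF that] oL_sum_ge(1)[OF that, of \<nu>L \<nu>R "conjugate G'"]
    by (blast intro: order_trans)
  moreover have "\<nu>L a \<le> \<nu>L 0" "\<nu>R 0 \<le> \<nu>R a" for a
    using trivial[of a] by simp_all
  moreover have "proper G" "proper (conjugate G)"
    using step.hyps assms(2) by (blast intro: universe_proper universe_conjugate)+
  ultimately show ?case
    by (intro conjI oL_sum_leI oR_sum_geI) (auto simp: opts_conjugate)
qed

text \<open>Copying again, but now the first player always has a move in \<open>H\<close>. The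
  adjoint is built inside the induction rather than by a recursive definition, so membership in
  \<open>U\<close> comes along with it.\<close>

lemma exists_adjoint:
  fixes \<nu>L \<nu>R :: "'a::linordered_ab_group_add \<Rightarrow> 's::linorder"
  assumes trivial: "\<And>a :: 'a. a = 0" and "universe U" "parental U" "G \<in> U"
  shows "\<exists>H\<in>U. oL \<nu>L \<nu>R (G \<oplus> H) \<le> \<nu>R 0 \<and> \<nu>L 0 \<le> oR \<nu>L \<nu>R (G \<oplus> H)"
  using assms(2,4)
proof (induction rule: universe_induct)
  case (step G)
  define Z :: "'a game" where "Z = Game (Atom 0) (Atom 0)"
  have nu: "\<nu>L 0 \<le> \<nu>L a" "\<nu>R a \<le> \<nu>R 0" for a
    using trivial[of a] by simp_all
  have "\<forall>G'\<in>fset (opts (left G) |\<union>| opts (right G)). \<exists>H.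
          H \<in> U \<and> oL \<nu>L \<nu>R (G' \<oplus> H) \<le> \<nu>R 0 \<and> \<nu>L 0 \<le> oR \<nu>L \<nu>R (G' \<oplus> H)"
    using step.IH by auto
  from bchoice[OF this] obtain adj where
    adj: "adj G' \<in> U" "oL \<nu>L \<nu>R (G' \<oplus> adj G') \<le> \<nu>R 0"
      "\<nu>L 0 \<le> oR \<nu>L \<nu>R (G' \<oplus> adj G')"
    if "G' |\<in>| opts (left G) |\<union>| opts (right G)" for G'
    by blast
  \<comment> \<open>Turns a side of \<open>G\<close> into the opposite side of \<open>H\<close>. The
    default \<open>Z\<close> keeps both sides of \<open>H\<close> non-empty, as parentality
    demands.\<close>
  define A where "A X = (if opts X = {||} then {|Z|} else adj |`| opts X)" for X
  define H where "H = Game (Options (A (right G))) (Options (A (left G)))"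
  have "A X \<noteq> {||}" for X
    by (simp add: A_def)
  moreover have "fset (A (left G)) \<subseteq> U" "fset (A (right G)) \<subseteq> U"
    using adj(1) universe_number[OF assms(2)] by (auto simp: A_def Z_def)
  ultimately have "H \<in> U" and "proper H"
    using assms(3) by (auto simp: parental_def H_def proper_def)
  have "proper G"
    using step.hyps assms(2) by (rule universe_proper[rotated])
  have "oL \<nu>L \<nu>R (G \<oplus> H) \<le> \<nu>R 0"
  proof (rule oL_sum_leI[OF \<open>proper G\<close> \<open>proper H\<close>])
    fix G' assume G': "G' |\<in>| opts (left G)"
    then have "adj G' |\<in>| opts (right H)"
      by (auto simp: H_def A_def)
    from oR_sum_le(2)[OF this] show "oR \<nu>L \<nu>R (G' \<oplus> H) \<le> \<nu>R 0"
      using adj(2)[of G'] G' order_trans by blast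
  next
    fix H' assume "H' |\<in>| opts (left H)"
    then have "H' |\<in>| A (right G)" by (simp add: H_def)
    then consider (adjoint) G' where "G' |\<in>| opts (right G)" "H' = adj G'"
      | (zero) "opts (right G) = {||}" "H' = Z"
      by (auto simp: A_def split: if_splits)
    then show "oR \<nu>L \<nu>R (G \<oplus> H') \<le> \<nu>R 0"
    proof cases
      case (adjoint G')
      from oR_sum_le(1)[OF adjoint(1)] show ?thesis
        using adj(2)[of G'] adjoint order_trans by blast
    next
      \<comment> \<open>Left has moved to \<open>Z\<close>. Right has no move in \<open>G\<close> or
        in \<open>Z\<close>, so play ends with value \<open>\<nu>R 0\<close>.\<close>
      case zero
      then obtain r where "right G = Atom r"
        using \<open>proper G\<close> by (cases "right G") (auto simp: proper_def)
      then show ?thesis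
        using zero nu(2) by (simp add: oR_Atom right_game_sum Z_def)
    qed
  \<comment> \<open>The case of two atoms cannot occur, because \<open>left H\<close> consists of
    options.\<close>
  qed (simp add: H_def)
  moreover have "\<nu>L 0 \<le> oR \<nu>L \<nu>R (G \<oplus> H)"
  proof (rule oR_sum_geI[OF \<open>proper G\<close> \<open>proper H\<close>])
    fix G' assume G': "G' |\<in>| opts (right G)"
    then have "adj G' |\<in>| opts (left H)"
      by (auto simp: H_def A_def)
    from oL_sum_ge(2)[OF this] show "\<nu>L 0 \<le> oL \<nu>L \<nu>R (G' \<oplus> H)"
      using adj(3)[of G'] G' order_trans by blast
  next
    fix H' assume "H' |\<in>| opts (right H)"
    then have "H' |\<in>| A (left G)" by (simp add: H_def)
    then consider (adjoint) G' where "G' |\<in>| opts (left G)" "H' = adj G'"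
      | (zero) "opts (left G) = {||}" "H' = Z"
      by (auto simp: A_def split: if_splits)
    then show "\<nu>L 0 \<le> oL \<nu>L \<nu>R (G \<oplus> H')"
    proof cases
      case (adjoint G')
      from oL_sum_ge(1)[OF adjoint(1)] show ?thesis
        using adj(3)[of G'] adjoint order_trans by blast
    next
      case zero
      then obtain l where "left G = Atom l"
        using \<open>proper G\<close> by (cases "left G") (auto simp: proper_def)
      then show ?thesis
        using zero nu(1) by (simp add: oL_Atom left_game_sum Z_def)
    qed
  qed (simp add: H_def)
  ultimately show ?case
    using \<open>H \<in> U\<close> by blast
qed

section \<open>Combining the cases\<close>

lemma exists_second_player_bounds:
  fixes \<nu>L \<nu>R :: "'a::linordered_ab_group_add \<Rightarrow> 's::linorder"
  assumes "evaluation S \<nu>L \<nu>R" "universe U" "parental U" "G \<in> U" "x \<in> S" "y \<in> S"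
  shows "\<exists>H1\<in>U. \<exists>H2\<in>U. x \<le> oR \<nu>L \<nu>R (G \<oplus> H1) \<and> oL \<nu>L \<nu>R (G \<oplus> H2) \<le> y"
proof (cases "\<nu>L = \<nu>R")
  case True
  then obtain c d where "x = \<nu>L c" "y = \<nu>L d" "mono \<nu>L"
    using assms(1,5,6) by (auto simp: evaluation_def)
  then obtain a b where "x \<le> oR \<nu>L \<nu>L (G \<oplus> Game (Atom a) (Atom a))"
      "oL \<nu>L \<nu>L (G \<oplus> Game (Atom b) (Atom b)) \<le> y"
    using eventually_outcome_ge[OF _ assms(2,4), of \<nu>L c]
      eventually_outcome_le[OF _ assms(2,4), of \<nu>L d]
    by (auto simp: eventually_at_top_linorder eventually_at_bot_linorder)
  then show ?thesis
    using True universe_number[OF assms(2)] by blast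
next
  case False
  then have trivial: "a = 0" for a :: 'a
    using assms(1) by (auto simp: evaluation_def)
  \<comment> \<open>The group has one element, so \<open>S\<close> consists of
    \<open>\<nu>L 0\<close> and \<open>\<nu>R 0\<close> only.\<close>
  then have "range f = {f 0}" for f :: "'a \<Rightarrow> 's"
    by (metis image_insert image_empty UNIV_eq_I insertI1)
  moreover have "S = range \<nu>L \<union> range \<nu>R"
    using assms(1) by (simp add: evaluation_def)
  ultimately have "S = {\<nu>L 0, \<nu>R 0}"
    by auto
  then have S: "x \<in> {\<nu>L 0, \<nu>R 0}" "y \<in> {\<nu>L 0, \<nu>R 0}"
    using assms(5,6) by simp_all
  \<comment> \<open>Reaching the maximum and the minimum of \<open>S\<close> at once handles every
    choice of \<open>x\<close> and \<open>y\<close> with the same \<open>H\<close>.\<close>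
  obtain H where "H \<in> U" "max (\<nu>L 0) (\<nu>R 0) \<le> oR \<nu>L \<nu>R (G \<oplus> H)"
      "oL \<nu>L \<nu>R (G \<oplus> H) \<le> min (\<nu>L 0) (\<nu>R 0)"
  proof (cases "\<nu>L 0 \<le> \<nu>R 0")
    case True
    then show ?thesis
      using outcome_sum_conjugate[OF trivial assms(2,4), of \<nu>L \<nu>R]
        universe_conjugate[OF assms(2,4)] that by (simp add: max_def min_def)
  next
    case False
    then show ?thesis
      using exists_adjoint[OF trivial assms(2,3,4), of \<nu>L \<nu>R] that
      by (auto simp: max_def min_def)
  qed
  then show ?thesis
    using S by (intro bexI[of _ H] conjI) auto
qed

theorem theorem24:
  fixes U :: "'a::linordered_ab_group_add game set"
    and S :: "'s::linorder set"
    and \<nu>L \<nu>R :: "'a \<Rightarrow> 's"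
  assumes "evaluation S \<nu>L \<nu>R"
    and "universe U"
    and "parental U"
  shows "outcome_saturated S \<nu>L \<nu>R U"
  unfolding outcome_saturated_def
proof (intro ballI)
  fix G x y assume "G \<in> U" "x \<in> S" "y \<in> S"
  then obtain H1 H2 where H: "H1 \<in> U" "H2 \<in> U"
      "x \<le> oR \<nu>L \<nu>R (G \<oplus> H1)" "oL \<nu>L \<nu>R (G \<oplus> H2) \<le> y"
    using exists_second_player_bounds[OF assms] by blast
  let ?H = "Game (Options {|H1|}) (Options {|H2|})"
  have "?H \<in> U"
    using H(1,2) assms(3) by (simp add: parental_def)
  moreover have "x \<le> oL \<nu>L \<nu>R (G \<oplus> ?H)"
    using oL_sum_ge(2)[of H1 ?H \<nu>L \<nu>R G] H(3) by simp
  moreover have "oR \<nu>L \<nu>R (G \<oplus> ?H) \<le> y"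
    using oR_sum_le(2)[of H2 ?H \<nu>L \<nu>R G] H(4) by simp
  ultimately show "\<exists>H\<in>U. x \<le> oL \<nu>L \<nu>R (G \<oplus> H) \<and> oR \<nu>L \<nu>R (G \<oplus> H) \<le> y"
    by blast
qed

end
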